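(* Let $0<\epsilon\le 1/2$ and let $\epsilon_c=1-\sqrt2/2$. For the saturated two-queue system with correlated channels of transition probability $\epsilon$ and one-slot switchover time, the rate region $\mathbf\Lambda_s$ is the set of all $(\lambda_1,\lambda_2)$ with $\lambda_1\ge0$, $\lambda_2\ge0$ that satisfy the following. If $\epsilon<\epsilon_c$: $$\epsilon\lambda_1+(1-\epsilon)^2\lambda_2\le\frac{(1-\epsilon)^2}{2},$$ $$(1-\epsilon)\lambda_1+(1+\epsilon-\epsilon^2)\lambda_2\le\frac34-\frac\epsilon2,$$ $$\lambda_1+\lambda_2\le\frac34-\frac\epsilon2,$$ $$(1+\epsilon-\epsilon^2)\lambda_1+(1-\epsilon)\lambda_2\le\frac34-\frac\epsilon2,$$ $$(1-\epsilon)^2\lambda_1+\epsilon\lambda_2\le\frac{(1-\epsilon)^2}{2}.$$ If $\epsilon\ge\epsilon_c$: $$\lambda_1+(1-\epsilon)(3-2\epsilon)\lambda_2\le\frac{(1-\epsilon)(3-2\epsilon)}{2},$$ $$\lambda_1+\lambda_2\le\frac34-\frac\epsilon2,$$ $$(1-\epsilon)(3-2\epsilon)\lambda_1+\lambda_2\le\frac{(1-\epsilon)(3-2\epsilon)}{2}.$$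
   Context: Saturated system. Time is slotted, $t\in\{0,1,2,\dots\}$. There are two parallel queues that are always non-empty, and one server. At slot $t$ the server is at queue $m(t)\in\{1,2\}$. It observes the channel states $(C_1(t),C_2(t))\in\{0,1\}^2$ ($1$ = ON, $0$ = OFF) and chooses an action $a_t\in\{0,1\}$: $a_t=1$ means stay at the current queue ($m(t+1)=m(t)$), and $a_t=0$ means switch to the other queue ($m(t+1)\ne m(t)$). Switching takes the whole slot. One packet departs from queue $i$ in slot $t$ exactly when $m(t)=i$, $C_i(t)=1$ and $a_t=1$; let $r_i(t)\in\{0,1\}$ indicate this event. Correlated channels. $C_1$ and $C_2$ are independent of each other. Each is a two-state Markov chain on $\{0,1\}$ which changes state with probability $\epsilon$ and keeps its state with probability $1-\epsilon$ in each slot. Policies and $\mathbf\Lambda_s$. A policy chooses $a_t$, possibly at random, from the history observed up to slot $t$; it may be history dependent, randomized and non-stationary. $\mathbf\Lambda_s$ is the set of all time average expected departure rate pairs $(\bar r_1,\bar r_2)$, with $\bar r_i=\lim_{K\to\infty}\frac1K\mathbb E\big[\sum_{t=1}^K r_i(t)\big]$, that can be obtained in the saturated system under all possible policies. Equivalently, let the states be $s=(m,C_1,C_2)$ (8 states), with transition probabilities $\mathbf P(s'|s,a)$ determined by the dynamics above. Let $\mathbf X$ be the set of $\mathbf x=(x(s;a))\in\mathbb R^{16}$ with $x(s;a)\ge0$, $\sum_{s}(x(s;1)+x(s;0))=1$, and $x(s;1)+x(s;0)=\sum_{s'}\sum_{a\in\{0,1\}}\mathbf P(s|s',a)\,x(s';a)$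 for every $s$. Then $\mathbf\Lambda_s=\{(\bar r_1,\bar r_2): \bar r_1=x(1,1,1;1)+x(1,1,0;1),\ \bar r_2=x(2,1,1;1)+x(2,0,1;1),\ \mathbf x\in\mathbf X\}$. *)

theory Defs
  imports "HOL-Probability.Probability"
begin

datatype queue = Q1 | Q2

datatype action = Stay | Switch

(* (m, C1, C2): position of the server and the two channel states, True being ON. *)
type_synonym state = "queue \<times> bool \<times> bool"

fun move :: "action \<Rightarrow> queue \<Rightarrow> queue" where
  "move Stay m = m"
| "move Switch Q1 = Q2"
| "move Switch Q2 = Q1"

definition channel_step :: "real \<Rightarrow> bool \<Rightarrow> bool pmf" where
  "channel_step \<epsilon> c = map_pmf (\<lambda>flip. if flip then \<not> c else c) (bernoulli_pmf \<epsilon>)"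

fun kernel :: "real \<Rightarrow> state \<Rightarrow> action \<Rightarrow> state pmf" where
  "kernel \<epsilon> (m, c1, c2) a =
     map_pmf (\<lambda>(c1', c2'). (move a m, c1', c2'))
       (pair_pmf (channel_step \<epsilon> c1) (channel_step \<epsilon> c2))"

fun channel :: "queue \<Rightarrow> state \<Rightarrow> bool" where
  "channel Q1 (m, c1, c2) = c1"
| "channel Q2 (m, c1, c2) = c2"

definition departure :: "queue \<Rightarrow> state \<times> action \<Rightarrow> real" where
  "departure i = (\<lambda>(s, a). of_bool (fst s = i \<and> channel i s \<and> a = Stay))"

(* A policy maps the record of the past slots (states and actions, oldest first) and the
   current state to a distribution over actions. The length of the record is the current
   time, so policies may be non-stationary. *)
type_synonym history = "(state \<times> action) list"
type_synonym policy = "history \<Rightarrow> state \<Rightarrow> action pmf"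

definition initial_state :: "queue \<Rightarrow> bool pmf \<Rightarrow> bool pmf \<Rightarrow> state pmf" where
  "initial_state m0 p1 p2 = map_pmf (\<lambda>(c1, c2). (m0, c1, c2)) (pair_pmf p1 p2)"

(* Joint law of the record of slots 0, ..., t - 1 and of the state in slot t. *)
primrec run :: "real \<Rightarrow> state pmf \<Rightarrow> policy \<Rightarrow> nat \<Rightarrow> (history \<times> state) pmf" where
  "run \<epsilon> p0 \<pi> 0 = map_pmf (\<lambda>s. ([], s)) p0"
| "run \<epsilon> p0 \<pi> (Suc t) =
     bind_pmf (run \<epsilon> p0 \<pi> t) (\<lambda>(h, s).
       bind_pmf (\<pi> h s) (\<lambda>a.
         map_pmf (\<lambda>s'. (h @ [(s, a)], s')) (kernel \<epsilon> s a)))"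

(* The record of a run of length K + 1 covers the slots 0, ..., K. *)
definition mean_departures :: "real \<Rightarrow> state pmf \<Rightarrow> policy \<Rightarrow> queue \<Rightarrow> nat \<Rightarrow> real" where
  "mean_departures \<epsilon> p0 \<pi> i K =
     measure_pmf.expectation (run \<epsilon> p0 \<pi> (Suc K))
       (\<lambda>(h, s). \<Sum>t = 1..K. departure i (h ! t))"

definition has_rate :: "real \<Rightarrow> state pmf \<Rightarrow> policy \<Rightarrow> queue \<Rightarrow> real \<Rightarrow> bool" where
  "has_rate \<epsilon> p0 \<pi> i r \<longleftrightarrow>
     (\<lambda>K. 1 / real K * mean_departures \<epsilon> p0 \<pi> i K) \<longlonglongrightarrow> r"

definition rate_region :: "real \<Rightarrow> state pmf \<Rightarrow> (real \<times> real) set" where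
  "rate_region \<epsilon> p0 =
     {(r1, r2). \<exists>\<pi>. has_rate \<epsilon> p0 \<pi> Q1 r1 \<and> has_rate \<epsilon> p0 \<pi> Q2 r2}"

end

theory Submission
  imports Defs
begin

text \<open>
  The saturated system is a Markov decision problem with eight states and two actions, and the
  claim describes its set of long-run average reward vectors. Both inclusions rest on average-cost
  optimality (Bellman) inequalities. Fix weights \<open>w1\<close>, \<open>w2\<close>, a number \<open>g\<close> and a potential \<open>h\<close> on the
  states, and call \<open>slack s a\<close> the amount by which \<open>g + h s\<close> exceeds the weighted reward of action
  \<open>a\<close> in state \<open>s\<close> plus the expected potential of the next state. Along a trajectory the potentials
  telescope: in expectation, the weighted reward of \<open>t\<close> slots is \<open>g * t\<close> minus the collected slack, up
  to a difference of two potentials. This gives two facts.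

  If the slack is nowhere negative, every policy, however it depends on the past, collects at most
  \<open>g * t + O(1)\<close> weighted departures in \<open>t\<close> slots; hence \<open>w1 * r1 + w2 * r2 \<le> g\<close> for all
  achievable rates (\<open>weighted_rate_le\<close>). If a stationary policy only uses actions of slack zero, it
  collects \<open>g * t + O(1)\<close>. So a policy with zero slack for two inequalities at once has a rate pair
  on both lines, and this determines the pair when the lines are not parallel
  (\<open>stationary_universal_rates\<close>).

  Each edge of the region needs an explicit potential. The potentials below solve the linear
  system saying that a policy optimal for that edge has slack zero, normalised to \<open>0\<close> where the
  server is at the first queue and both channels are OFF. Exchanging the queues (\<open>mirror\<close>) reduces
  the edges to those on the side \<open>r2 \<le> r1\<close>. There the vertices other than the origin come from
  three policies: always going to the first queue, rate \<open>(1/2, 0)\<close>; serving the first queue unless only the second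
  is connected; and serving a connected queue, without switching when both are connected and going
  to the first queue when none is.

  The critical value enters through \<open>1 - 4 * \<epsilon> + 2 * \<epsilon>\<^sup>2\<close>, which changes sign at
  \<open>\<epsilon> = 1 - sqrt 2 / 2\<close>. The second and third policy differ only at the second queue
  with both channels ON. There this polynomial is the slack of the third policy's action on the
  outer edge for slow channels, and its negative is, up to scaling, the slack of the second policy's
  action on the outer edge for fast channels. It is also the determinant of the two edges that meet
  at the second policy. When the channels change slowly the second policy is a vertex; at the
  critical value its two edges become parallel, and beyond it a single edge joins the other two
  policies.

  The achievable set is convex because the first action, which stays on record, can serve as the
  coin that selects one of two policies (\<open>convex_universal_rates\<close>). The polygon is the union of the
  triangles spanned by the origin and two neighbouring vertices, so every point of it is a convex
  combination of achievable points (\<open>convex_sector\<close>).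
\<close>

section \<open>Expectations over finite supports\<close>

lemma finite_states: "finite (A :: state set)"
proof -
  have "finite (UNIV :: queue set)"
    by (rule finite_subset[of _ "{Q1, Q2}"]) (use queue.exhaust in auto)
  then have "finite (UNIV :: state set)"
    by (simp add: finite_prod)
  then show ?thesis
    by (rule rev_finite_subset) simp
qed

lemma finite_actions: "finite (A :: action set)"
  by (rule finite_subset[of _ "{Stay, Switch}"]) (use action.exhaust in auto)

lemma integrable_finite_pmf:
  fixes f :: "'b \<Rightarrow> real"
  assumes "finite (set_pmf p)"
  shows "integrable (measure_pmf p) f"
  using assms by (rule integrable_measure_pmf_finite)

lemma expectation_bind_pmf_finite:
  fixes f :: "'b \<Rightarrow> real"
  assumes "finite (set_pmf p)" and "\<And>x. x \<in> set_pmf p \<Longrightarrow> finite (set_pmf (k x))"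
  shows "measure_pmf.expectation (bind_pmf p k) f
    = measure_pmf.expectation p (\<lambda>x. measure_pmf.expectation (k x) f)"
  using assms by (simp add: pmf_expectation_bind[of "set_pmf p"] integral_measure_pmf[of "set_pmf p"])

lemma expectation_channel_step:
  fixes f :: "bool \<Rightarrow> real"
  assumes "0 \<le> \<epsilon>" and "\<epsilon> \<le> 1"
  shows "measure_pmf.expectation (channel_step \<epsilon> c) f = (1 - \<epsilon>) * f c + \<epsilon> * f (\<not> c)"
  unfolding channel_step_def using assms by simp

lemma expectation_kernel:
  fixes f :: "state \<Rightarrow> real"
  assumes "0 \<le> \<epsilon>" and "\<epsilon> \<le> 1"
  shows "measure_pmf.expectation (kernel \<epsilon> (m, c1, c2) a) f =
      (1 - \<epsilon>)\<^sup>2 * f (move a m, c1, c2)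
    + (1 - \<epsilon>) * \<epsilon> * (f (move a m, c1, \<not> c2) + f (move a m, \<not> c1, c2))
    + \<epsilon>\<^sup>2 * f (move a m, \<not> c1, \<not> c2)"
  unfolding kernel.simps pair_pmf_def using assms
  by (simp add: expectation_bind_pmf_finite map_bind_pmf expectation_channel_step
      algebra_simps power2_eq_square)

text \<open>The kernel is used through its expectations, except for the symmetry under exchanging the queues.\<close>

declare kernel.simps [simp del]

lemma bounded_on_states:
  fixes h :: "state \<Rightarrow> real"
  shows "\<exists>M. \<forall>s. \<bar>h s\<bar> \<le> M"
proof
  show "\<forall>s. \<bar>h s\<bar> \<le> Max (range (\<lambda>s. \<bar>h s\<bar>))"
    by (intro allI Max_ge finite_imageI finite_states) simp
qed

section \<open>Runs decomposed at the first slot\<close>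

lemma finite_run: "finite (set_pmf (run \<epsilon> p0 \<pi> t))"
  by (induction t) (auto simp: finite_states finite_actions)

lemma length_run: "x \<in> set_pmf (run \<epsilon> p0 \<pi> t) \<Longrightarrow> length (fst x) = t"
  by (induction t arbitrary: x) auto

lemma run_mixture:
  "run \<epsilon> p0 \<pi> t = bind_pmf p0 (\<lambda>s. run \<epsilon> (return_pmf s) \<pi> t)"
  by (induction t) (simp_all add: map_pmf_def bind_return_pmf bind_assoc_pmf)

text \<open>\<open>run\<close> is defined by its last slot. Unfolding the first slot instead makes the policy after that
  slot an arbitrary policy again, so that statements about all policies can be proved by induction
  on the number of slots.\<close>

lemma run_first_step:
  "run \<epsilon> (return_pmf s) \<pi> (Suc t) =
     bind_pmf (\<pi> [] s) (\<lambda>a. bind_pmf (kernel \<epsilon> s a) (\<lambda>s'.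
       map_pmf (\<lambda>(h, u). ((s, a) # h, u))
         (run \<epsilon> (return_pmf s') (\<lambda>h. \<pi> ((s, a) # h)) t)))"
proof (induction t)
  case 0
  show ?case by (simp add: bind_return_pmf map_pmf_def bind_assoc_pmf)
next
  case (Suc t)
  show ?case
    unfolding run.simps(2)[of _ _ _ "Suc t"] Suc.IH
    by (simp add: map_pmf_def bind_return_pmf bind_assoc_pmf case_prod_beta)
qed

section \<open>Departure counts and rates\<close>

text \<open>This counts slots \<open>0\<close> to \<open>t - 1\<close>. Slot \<open>0\<close>, which \<open>mean_departures\<close> leaves out, is included so
  that the count satisfies a recursion on the first slot; the rates do not change.\<close>

definition total_departures ::
  "real \<Rightarrow> state pmf \<Rightarrow> policy \<Rightarrow> queue \<Rightarrow> nat \<Rightarrow> real" where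
  "total_departures \<epsilon> p0 \<pi> i t =
     measure_pmf.expectation (run \<epsilon> p0 \<pi> t) (\<lambda>(h, s). \<Sum>x\<leftarrow>h. departure i x)"

lemma total_departures_0 [simp]: "total_departures \<epsilon> p0 \<pi> i 0 = 0"
  by (simp add: total_departures_def)

lemma total_departures_mixture:
  "total_departures \<epsilon> p0 \<pi> i t
     = measure_pmf.expectation p0 (\<lambda>s. total_departures \<epsilon> (return_pmf s) \<pi> i t)"
  unfolding total_departures_def
  by (subst run_mixture) (simp add: expectation_bind_pmf_finite finite_run finite_states)

lemma total_departures_first_step:
  "total_departures \<epsilon> (return_pmf s) \<pi> i (Suc t) =
     measure_pmf.expectation (\<pi> [] s) (\<lambda>a. departure i (s, a)
       + measure_pmf.expectation (kernel \<epsilon> s a)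
           (\<lambda>s'. total_departures \<epsilon> (return_pmf s') (\<lambda>h. \<pi> ((s, a) # h)) i t))"
proof -
  have "measure_pmf.expectation (run \<epsilon> (return_pmf s') \<rho> t)
          (\<lambda>x. departure i (s, a) + (\<Sum>y\<leftarrow>fst x. departure i y))
      = departure i (s, a) + measure_pmf.expectation (run \<epsilon> (return_pmf s') \<rho> t)
          (\<lambda>x. \<Sum>y\<leftarrow>fst x. departure i y)" for s' a \<rho>
    by (simp add: integrable_finite_pmf finite_run)
  then show ?thesis
    unfolding total_departures_def run_first_step
    by (simp add: expectation_bind_pmf_finite finite_run finite_states finite_actions
        case_prod_unfold integrable_finite_pmf del: run.simps(2))
qed

lemma departure_bounds: "0 \<le> departure i x" "departure i x \<le> 1"
  by (auto simp: departure_def case_prod_beta)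

lemma total_departures_nonneg: "0 \<le> total_departures \<epsilon> p0 \<pi> i t"
  unfolding total_departures_def
  by (rule Bochner_Integration.integral_nonneg)
    (auto intro!: sum_list_nonneg simp: departure_bounds)

lemma total_departures_le: "total_departures \<epsilon> p0 \<pi> i t \<le> t"
proof -
  have "(\<Sum>x\<leftarrow>h. departure i x) \<le> length h" for h
    by (induction h) (use departure_bounds(2) in \<open>auto simp: add.commute add_mono\<close>)
  then have "total_departures \<epsilon> p0 \<pi> i t
      \<le> measure_pmf.expectation (run \<epsilon> p0 \<pi> t) (\<lambda>x. real t)"
    unfolding total_departures_def
    by (intro integral_mono_AE integrable_finite_pmf finite_run)
      (auto simp: AE_measure_pmf_iff dest!: length_run)
  then show ?thesis by simp
qed

lemma mean_departures_near_total:
  "\<bar>mean_departures \<epsilon> p0 \<pi> i K - total_departures \<epsilon> p0 \<pi> i (Suc K)\<bar> \<le> 1"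
proof -
  let ?R = "run \<epsilon> p0 \<pi> (Suc K)"
  have *: "(\<Sum>x\<leftarrow>h. departure i x) = departure i (h ! 0) + (\<Sum>t = 1..K. departure i (h ! t))"
    if "length h = Suc K" for h
    using that by (simp add: sum_list_sum_nth atLeastLessThanSuc_atLeastAtMost
        sum.atLeast_Suc_atMost del: sum.op_ivl_Suc)
  have "total_departures \<epsilon> p0 \<pi> i (Suc K)
      = measure_pmf.expectation ?R (\<lambda>(h, s). departure i (h ! 0) + (\<Sum>t = 1..K. departure i (h ! t)))"
    unfolding total_departures_def
    by (intro integral_cong_AE) (auto simp: AE_measure_pmf_iff * dest!: length_run simp del: run.simps)
  also have "\<dots> = measure_pmf.expectation ?R (\<lambda>x. departure i (fst x ! 0))
      + mean_departures \<epsilon> p0 \<pi> i K"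
    unfolding mean_departures_def case_prod_beta
    by (rule Bochner_Integration.integral_add; rule integrable_finite_pmf, rule finite_run)
  finally have "total_departures \<epsilon> p0 \<pi> i (Suc K) - mean_departures \<epsilon> p0 \<pi> i K
      = measure_pmf.expectation ?R (\<lambda>x. departure i (fst x ! 0))" by simp
  moreover have "0 \<le> measure_pmf.expectation ?R (\<lambda>x. departure i (fst x ! 0))"
    by (simp add: departure_bounds)
  moreover have "measure_pmf.expectation ?R (\<lambda>x. departure i (fst x ! 0))
      \<le> measure_pmf.expectation ?R (\<lambda>x. 1)"
    by (intro integral_mono integrable_finite_pmf finite_run departure_bounds)
  ultimately show ?thesis by simp
qed

text \<open>Counting slot \<open>0\<close> and dividing by \<open>K + 1\<close> instead of \<open>K\<close> each change the average by at most
  \<open>1 / K\<close>.\<close>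

lemma has_rate_iff_total_departures:
  "has_rate \<epsilon> p0 \<pi> i r \<longleftrightarrow> (\<lambda>t. total_departures \<epsilon> p0 \<pi> i t / t) \<longlonglongrightarrow> r"
proof -
  let ?T = "total_departures \<epsilon> p0 \<pi> i" and ?D = "mean_departures \<epsilon> p0 \<pi> i"
  have "\<bar>1 / real K * ?D K - ?T (Suc K) / Suc K\<bar> \<le> 2 / K" if "0 < K" for K
  proof -
    have *: "1 / k * d - T / (1 + k) = (d - T) / k + (T / (1 + k)) / k" if "0 < k" for k d T :: real
      using that by (simp add: divide_simps) (simp add: algebra_simps)
    have "1 / real K * ?D K - ?T (Suc K) / Suc K
        = (?D K - ?T (Suc K)) / K + (?T (Suc K) / Suc K) / K"
      using that *[of K] by simp
    also have "\<bar>\<dots>\<bar> \<le> \<bar>?D K - ?T (Suc K)\<bar> / K + \<bar>?T (Suc K) / Suc K\<bar> / K"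
      by (rule order.trans[OF abs_triangle_ineq]) (simp add: abs_divide)
    also have "\<dots> \<le> 1 / K + 1 / K"
      using mean_departures_near_total[of \<epsilon> p0 \<pi> i K] total_departures_nonneg[of \<epsilon> p0 \<pi> i "Suc K"]
        total_departures_le[of \<epsilon> p0 \<pi> i "Suc K"]
      by (intro add_mono divide_right_mono) (auto simp: abs_divide)
    finally show ?thesis by simp
  qed
  then have "(\<lambda>K. 1 / real K * ?D K - ?T (Suc K) / Suc K) \<longlonglongrightarrow> 0"
    by (intro Lim_null_comparison[OF _ lim_const_over_n[of 2]])
      (auto intro!: eventually_sequentiallyI[of 1])
  then have "(\<lambda>K. 1 / real K * ?D K) \<longlonglongrightarrow> r \<longleftrightarrow> (\<lambda>K. ?T (Suc K) / Suc K) \<longlonglongrightarrow> r"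
    by (rule Lim_transform_eq)
  also have "\<dots> \<longleftrightarrow> (\<lambda>t. ?T t / t) \<longlonglongrightarrow> r"
    using filterlim_sequentially_Suc[of "\<lambda>t. ?T t / real t" "nhds r"] .
  finally show ?thesis
    unfolding has_rate_def .
qed

lemma has_rate_nonneg:
  assumes "has_rate \<epsilon> p0 \<pi> i r"
  shows "0 \<le> r"
  using assms unfolding has_rate_iff_total_departures
  by (rule LIMSEQ_le_const) (auto simp: total_departures_nonneg)

text \<open>The count from a random initial state is a finite average of the counts from the fixed ones.\<close>

lemma has_rate_from_all_states:
  assumes "\<And>s. has_rate \<epsilon> (return_pmf s) \<pi> i r"
  shows "has_rate \<epsilon> p0 \<pi> i r"
proof -
  have "(\<lambda>t. \<Sum>s\<in>set_pmf p0. pmf p0 s * (total_departures \<epsilon> (return_pmf s) \<pi> i t / t))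
      \<longlonglongrightarrow> (\<Sum>s\<in>set_pmf p0. pmf p0 s * r)"
    using assms by (intro tendsto_intros) (simp add: has_rate_iff_total_departures)
  moreover have "(\<Sum>s\<in>set_pmf p0. pmf p0 s * r) = r"
    by (simp add: sum_pmf_eq_1 finite_states flip: sum_distrib_right)
  moreover have "(\<Sum>s\<in>set_pmf p0. pmf p0 s * (total_departures \<epsilon> (return_pmf s) \<pi> i t / t))
      = total_departures \<epsilon> p0 \<pi> i t / t" for t
    by (subst total_departures_mixture[of _ p0])
      (simp add: integral_measure_pmf_real[of "set_pmf p0"] finite_states sum_divide_distrib mult.commute)
  ultimately show ?thesis
    by (simp add: has_rate_iff_total_departures)
qed

section \<open>Slack of a potential and bounds on weighted rates\<close>

text \<open>The loss of action \<open>a\<close> in state \<open>s\<close> in the average-reward Bellman inequality with gain \<open>g\<close> and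
  relative value function \<open>h\<close>.\<close>

definition slack :: "real \<Rightarrow> real \<Rightarrow> real \<Rightarrow> real \<Rightarrow> (state \<Rightarrow> real) \<Rightarrow> state \<Rightarrow> action \<Rightarrow> real" where
  "slack \<epsilon> w1 w2 g h s a =
     g + h s - (w1 * departure Q1 (s, a) + w2 * departure Q2 (s, a)
       + measure_pmf.expectation (kernel \<epsilon> s a) h)"

abbreviation weighted_total ::
  "real \<Rightarrow> real \<Rightarrow> real \<Rightarrow> state pmf \<Rightarrow> policy \<Rightarrow> nat \<Rightarrow> real" where
  "weighted_total \<epsilon> w1 w2 p0 \<pi> t \<equiv>
     w1 * total_departures \<epsilon> p0 \<pi> Q1 t + w2 * total_departures \<epsilon> p0 \<pi> Q2 t"

text \<open>Here \<open>g\<close> and \<open>h\<close> are arbitrary: the identity only rewrites the reward of the first slot through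
  the slack. The potential of the next state is subtracted from the remaining count, which is the
  form in which induction on \<open>t\<close> telescopes.\<close>

lemma weighted_total_first_step:
  "weighted_total \<epsilon> w1 w2 (return_pmf s) \<pi> (Suc t) =
     measure_pmf.expectation (\<pi> [] s) (\<lambda>a. g + h s - slack \<epsilon> w1 w2 g h s a
       + measure_pmf.expectation (kernel \<epsilon> s a)
           (\<lambda>s'. weighted_total \<epsilon> w1 w2 (return_pmf s') (\<lambda>h. \<pi> ((s, a) # h)) t - h s'))"
proof -
  let ?T = "\<lambda>i a s'. total_departures \<epsilon> (return_pmf s') (\<lambda>h. \<pi> ((s, a) # h)) i t"
  let ?E = "\<lambda>a. measure_pmf.expectation (kernel \<epsilon> s a)"
  have "w1 * (departure Q1 (s, a) + ?E a (?T Q1 a)) + w2 * (departure Q2 (s, a) + ?E a (?T Q2 a))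
      = g + h s - slack \<epsilon> w1 w2 g h s a + ?E a (\<lambda>s'. w1 * ?T Q1 a s' + w2 * ?T Q2 a s' - h s')" for a
    by (simp add: slack_def integrable_finite_pmf finite_states ring_distribs)
  moreover have "w1 * measure_pmf.expectation (\<pi> [] s) (\<lambda>a. departure Q1 (s, a) + ?E a (?T Q1 a))
        + w2 * measure_pmf.expectation (\<pi> [] s) (\<lambda>a. departure Q2 (s, a) + ?E a (?T Q2 a))
      = measure_pmf.expectation (\<pi> [] s)
          (\<lambda>a. w1 * (departure Q1 (s, a) + ?E a (?T Q1 a))
             + w2 * (departure Q2 (s, a) + ?E a (?T Q2 a)))"
    by (subst Bochner_Integration.integral_add)
      (auto intro!: integrable_finite_pmf finite_actions simp only: integral_mult_right_zero)
  ultimately show ?thesis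
    unfolding total_departures_first_step by simp
qed

text \<open>The induction ranges over all policies, since the policy that remains after the first slot
  differs from the original one.\<close>

lemma weighted_total_upper_bound:
  assumes "\<And>s a. 0 \<le> slack \<epsilon> w1 w2 g h s a" and "\<And>s. - M \<le> h s"
  shows "weighted_total \<epsilon> w1 w2 (return_pmf s) \<pi> t \<le> g * t + h s + M"
proof (induction t arbitrary: s \<pi>)
  case 0
  show ?case using assms(2)[of s] by simp
next
  case (Suc t)
  have "weighted_total \<epsilon> w1 w2 (return_pmf s) \<pi> (Suc t)
      \<le> measure_pmf.expectation (\<pi> [] s) (\<lambda>a. g + h s - 0
       + measure_pmf.expectation (kernel \<epsilon> s a) (\<lambda>s'. g * t + M))"
    unfolding weighted_total_first_step[of _ _ _ _ _ _ g h]
    using Suc.IH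
    by (intro integral_mono add_mono diff_mono assms(1) order.refl integrable_finite_pmf
        finite_states finite_actions) (simp add: algebra_simps)
  then show ?case by (simp add: algebra_simps)
qed

lemma weighted_total_stationary:
  assumes tight: "\<And>s. slack \<epsilon> w1 w2 g h s (\<sigma> s) = 0" and M: "\<And>s. \<bar>h s\<bar> \<le> M"
  shows "\<bar>weighted_total \<epsilon> w1 w2 (return_pmf s) (\<lambda>_ s. return_pmf (\<sigma> s)) t - (g * t + h s)\<bar> \<le> M"
proof (induction t arbitrary: s)
  case 0
  show ?case using M[of s] by simp
next
  case (Suc t)
  let ?W = "\<lambda>s. weighted_total \<epsilon> w1 w2 (return_pmf s) (\<lambda>_ s. return_pmf (\<sigma> s)) t"
  let ?E = "measure_pmf.expectation (kernel \<epsilon> s (\<sigma> s))"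
  have "weighted_total \<epsilon> w1 w2 (return_pmf s) (\<lambda>_ s. return_pmf (\<sigma> s)) (Suc t)
      = g + h s + ?E (\<lambda>s'. ?W s' - h s')"
    unfolding weighted_total_first_step[of _ _ _ _ _ _ g h] by (simp add: tight)
  moreover have "?E (\<lambda>s'. ?W s' - h s') \<le> ?E (\<lambda>s'. g * t + M)"
    using Suc.IH by (intro integral_mono integrable_finite_pmf finite_states)
      (simp add: abs_le_iff algebra_simps)
  moreover have "?E (\<lambda>s'. g * t - M) \<le> ?E (\<lambda>s'. ?W s' - h s')"
    using Suc.IH by (intro integral_mono integrable_finite_pmf finite_states)
      (simp add: abs_le_iff algebra_simps)
  ultimately show ?case by (simp add: algebra_simps abs_le_iff)
qed

lemma weighted_rate_le:
  assumes "\<And>s a. 0 \<le> slack \<epsilon> w1 w2 g h s a"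
    and "has_rate \<epsilon> p0 \<pi> Q1 r1" and "has_rate \<epsilon> p0 \<pi> Q2 r2"
  shows "w1 * r1 + w2 * r2 \<le> g"
proof -
  obtain M where M: "\<And>s. \<bar>h s\<bar> \<le> M" using bounded_on_states[of h] by blast
  have bound: "weighted_total \<epsilon> w1 w2 p0 \<pi> t \<le> g * t + 2 * M" for t
  proof -
    have "weighted_total \<epsilon> w1 w2 p0 \<pi> t
        = measure_pmf.expectation p0 (\<lambda>s. weighted_total \<epsilon> w1 w2 (return_pmf s) \<pi> t)"
      by (subst (1 2) total_departures_mixture) (simp add: integrable_finite_pmf finite_states)
    also have "\<dots> \<le> measure_pmf.expectation p0 (\<lambda>s. g * t + 2 * M)"
    proof (intro integral_mono integrable_finite_pmf finite_states)
      fix s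
      have "- M \<le> h s" for s using M[of s] by (simp add: abs_le_iff)
      from weighted_total_upper_bound[OF assms(1) this, of s \<pi> t]
      show "weighted_total \<epsilon> w1 w2 (return_pmf s) \<pi> t \<le> g * t + 2 * M"
        using M[of s] by (simp add: abs_le_iff)
    qed
    finally show ?thesis by simp
  qed
  have "w1 * (total_departures \<epsilon> p0 \<pi> Q1 t / t) + w2 * (total_departures \<epsilon> p0 \<pi> Q2 t / t)
      \<le> g + 2 * M / t" if "0 < t" for t :: nat
    using divide_right_mono[OF bound[of t], of "real t"] that by (simp add: add_divide_distrib)
  moreover have "(\<lambda>t. w1 * (total_departures \<epsilon> p0 \<pi> Q1 t / t)
      + w2 * (total_departures \<epsilon> p0 \<pi> Q2 t / t)) \<longlonglongrightarrow> w1 * r1 + w2 * r2"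
    using assms(2,3) by (intro tendsto_intros) (simp_all add: has_rate_iff_total_departures)
  moreover have "(\<lambda>t. g + 2 * M / real t) \<longlonglongrightarrow> g + 0"
    by (intro tendsto_intros lim_const_over_n)
  ultimately have "w1 * r1 + w2 * r2 \<le> g + 0"
    by (intro LIMSEQ_le[of _ _ "\<lambda>t. g + 2 * M / real t"] exI[of _ 1]) auto
  then show ?thesis by simp
qed

lemma weighted_rate_stationary:
  assumes "\<And>s. slack \<epsilon> w1 w2 g h s (\<sigma> s) = 0"
  shows "(\<lambda>t. weighted_total \<epsilon> w1 w2 (return_pmf s) (\<lambda>_ s. return_pmf (\<sigma> s)) t / t) \<longlonglongrightarrow> g"
proof -
  let ?W = "weighted_total \<epsilon> w1 w2 (return_pmf s) (\<lambda>_ s. return_pmf (\<sigma> s))"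
  obtain M where M: "\<And>s. \<bar>h s\<bar> \<le> M" using bounded_on_states[of h] by blast
  have "\<bar>?W t / t - g\<bar> \<le> 2 * M / t" if "0 < t" for t
  proof -
    have "?W t / t - g = (?W t - g * t) / t"
      using that by (simp add: field_simps)
    moreover have "\<bar>?W t - g * t\<bar> \<le> 2 * M"
      using weighted_total_stationary[of \<epsilon> w1 w2 g h \<sigma> M s t, OF assms M] M[of s]
      unfolding abs_le_iff by linarith
    ultimately show ?thesis
      by (simp add: abs_divide divide_right_mono)
  qed
  then have "(\<lambda>t. ?W t / t - g) \<longlonglongrightarrow> 0"
    by (intro Lim_null_comparison[OF _ lim_const_over_n[of "2 * M"]])
      (auto intro!: eventually_sequentiallyI[of 1])
  then show ?thesis by (rule LIM_zero_cancel)
qed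

section \<open>Exchanging the two queues\<close>

text \<open>The system is symmetric under renaming the queues. This avoids separate potentials for the edges
  with the roles of the two rates exchanged.\<close>

fun mirror :: "state \<Rightarrow> state" where
  "mirror (m, c1, c2) = (move Switch m, c2, c1)"

lemma mirror_mirror [simp]: "mirror (mirror s) = s"
proof -
  obtain m c1 c2 where "s = (m, c1, c2)" by (rule prod_cases3)
  then show ?thesis by (cases m) auto
qed

lemma kernel_mirror: "kernel \<epsilon> (mirror s) a = map_pmf mirror (kernel \<epsilon> s a)"
proof -
  obtain m c1 c2 where s: "s = (m, c1, c2)" by (rule prod_cases3)
  have "move a (move Switch m) = move Switch (move a m)"
    by (cases a; cases m) auto
  then show ?thesis
    unfolding s mirror.simps kernel.simps
    by (subst pair_commute_pmf) (simp add: map_pmf_comp case_prod_beta)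
qed

lemma departure_mirror: "departure i (mirror s, a) = departure (move Switch i) (s, a)"
proof -
  obtain m c1 c2 where "s = (m, c1, c2)" by (rule prod_cases3)
  then show ?thesis by (cases m; cases i) (auto simp: departure_def)
qed

definition mirror_policy :: "policy \<Rightarrow> policy" where
  "mirror_policy \<pi> h s = \<pi> (map (\<lambda>(s, a). (mirror s, a)) h) (mirror s)"

lemma total_departures_mirror:
  "total_departures \<epsilon> (return_pmf (mirror s)) (mirror_policy \<pi>) i t
     = total_departures \<epsilon> (return_pmf s) \<pi> (move Switch i) t"
proof (induction t arbitrary: s \<pi>)
  case (Suc t)
  have "(\<lambda>h. mirror_policy \<pi> ((mirror s, a) # h)) = mirror_policy (\<lambda>h. \<pi> ((s, a) # h))" for a
    by (simp add: mirror_policy_def fun_eq_iff)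
  moreover have "mirror_policy \<pi> [] (mirror s) = \<pi> [] s"
    by (simp add: mirror_policy_def)
  ultimately show ?case
    unfolding total_departures_first_step by (simp add: kernel_mirror departure_mirror Suc.IH)
qed simp

lemma has_rate_mirror:
  assumes "has_rate \<epsilon> p0 \<pi> (move Switch i) r"
  shows "has_rate \<epsilon> (map_pmf mirror p0) (mirror_policy \<pi>) i r"
proof -
  have "total_departures \<epsilon> (map_pmf mirror p0) (mirror_policy \<pi>) i t
      = total_departures \<epsilon> p0 \<pi> (move Switch i) t" for t
    by (subst (1 2) total_departures_mixture) (simp add: total_departures_mirror)
  then show ?thesis
    using assms by (simp add: has_rate_iff_total_departures)
qed

lemma weighted_rate_le_swap:
  assumes "\<And>s a. 0 \<le> slack \<epsilon> w1 w2 g h s a"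
    and "has_rate \<epsilon> p0 \<pi> Q1 r1" and "has_rate \<epsilon> p0 \<pi> Q2 r2"
  shows "w2 * r1 + w1 * r2 \<le> g"
proof -
  have "has_rate \<epsilon> (map_pmf mirror p0) (mirror_policy \<pi>) Q1 r2"
    using assms(3) by (intro has_rate_mirror) simp
  moreover have "has_rate \<epsilon> (map_pmf mirror p0) (mirror_policy \<pi>) Q2 r1"
    using assms(2) by (intro has_rate_mirror) simp
  ultimately have "w1 * r2 + w2 * r1 \<le> g"
    by (rule weighted_rate_le[OF assms(1)])
  then show ?thesis by linarith
qed

section \<open>Rates achievable from every initial state\<close>

text \<open>One policy must serve all initial states. This uniformity makes the set convex: the state reached
  after the first slot is arbitrary, and the continuation must attain its rates from there.\<close>

definition universal_rates :: "real \<Rightarrow> (real \<times> real) set" where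
  "universal_rates \<epsilon> = {r. \<exists>\<pi>. \<forall>s.
     has_rate \<epsilon> (return_pmf s) \<pi> Q1 (fst r) \<and> has_rate \<epsilon> (return_pmf s) \<pi> Q2 (snd r)}"

lemma universal_rates_subset_rate_region: "universal_rates \<epsilon> \<subseteq> rate_region \<epsilon> p0"
  unfolding universal_rates_def rate_region_def case_prod_unfold using has_rate_from_all_states by blast

lemma universal_rates_swap:
  assumes "(r1, r2) \<in> universal_rates \<epsilon>"
  shows "(r2, r1) \<in> universal_rates \<epsilon>"
proof -
  from assms obtain \<pi> where \<pi>: "has_rate \<epsilon> (return_pmf s) \<pi> Q1 r1"
    "has_rate \<epsilon> (return_pmf s) \<pi> Q2 r2" for s
    unfolding universal_rates_def by (simp del: split_paired_All) blast
  have "has_rate \<epsilon> (return_pmf s) (mirror_policy \<pi>) Q1 r2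
      \<and> has_rate \<epsilon> (return_pmf s) (mirror_policy \<pi>) Q2 r1" for s
    using has_rate_mirror[of \<epsilon> "return_pmf (mirror s)" \<pi>] \<pi> by simp
  then show ?thesis
    unfolding universal_rates_def by (simp del: split_paired_All) blast
qed

text \<open>The first action is drawn at random and then read off the record, where it tells which of the two
  policies to follow from the second slot on. Both policies see a record without the first slot.\<close>

definition coin_policy :: "real \<Rightarrow> policy \<Rightarrow> policy \<Rightarrow> policy" where
  "coin_policy p \<pi> \<rho> h s = (case h of
       [] \<Rightarrow> map_pmf (\<lambda>b. if b then Stay else Switch) (bernoulli_pmf p)
     | (_, a) # h' \<Rightarrow> (if a = Stay then \<pi> else \<rho>) h' s)"

text \<open>Rates are expectations, so they mix linearly, and the slot spent on the coin does not affect
  averages.\<close>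

lemma has_rate_coin_policy:
  assumes p: "0 \<le> p" "p \<le> 1"
    and \<pi>: "\<And>s. has_rate \<epsilon> (return_pmf s) \<pi> i r" and \<rho>: "\<And>s. has_rate \<epsilon> (return_pmf s) \<rho> i q"
  shows "has_rate \<epsilon> (return_pmf s) (coin_policy p \<pi> \<rho>) i (p * r + (1 - p) * q)"
proof -
  let ?c = "p * departure i (s, Stay) + (1 - p) * departure i (s, Switch)"
  let ?A = "total_departures \<epsilon> (kernel \<epsilon> s Stay) \<pi> i"
  let ?B = "total_departures \<epsilon> (kernel \<epsilon> s Switch) \<rho> i"
  have after_coin: "(\<lambda>h. coin_policy p \<pi> \<rho> ((s, a) # h)) = (if a = Stay then \<pi> else \<rho>)" for a
    by (simp add: coin_policy_def fun_eq_iff)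
  have coin: "coin_policy p \<pi> \<rho> [] s = map_pmf (\<lambda>b. if b then Stay else Switch) (bernoulli_pmf p)"
    by (simp add: coin_policy_def)
  have T: "total_departures \<epsilon> (return_pmf s) (coin_policy p \<pi> \<rho>) i (Suc t)
      = ?c + p * ?A t + (1 - p) * ?B t" for t
    unfolding total_departures_first_step after_coin coin
    unfolding total_departures_mixture[of _ "kernel \<epsilon> s _"]
    by (simp add: p algebra_simps)
  have ratio: "(\<lambda>t. real t / real (Suc t)) \<longlonglongrightarrow> 1"
    by (rule LIMSEQ_n_over_Suc_n)
  have "(\<lambda>t. ?c / real (Suc t) + p * (?A t / t * (real t / real (Suc t)))
      + (1 - p) * (?B t / t * (real t / real (Suc t)))) \<longlonglongrightarrow> 0 + p * (r * 1) + (1 - p) * (q * 1)"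
    using has_rate_from_all_states[OF \<pi>, of "kernel \<epsilon> s Stay"] has_rate_from_all_states[OF \<rho>, of "kernel \<epsilon> s Switch"]
    unfolding has_rate_iff_total_departures
    by (intro tendsto_intros ratio LIMSEQ_Suc[OF lim_const_over_n])
  moreover have "?c / real (Suc t) + p * (?A t / t * (real t / real (Suc t)))
      + (1 - p) * (?B t / t * (real t / real (Suc t)))
      = total_departures \<epsilon> (return_pmf s) (coin_policy p \<pi> \<rho>) i (Suc t) / real (Suc t)" for t
    by (cases "t = 0") (simp_all add: T add_divide_distrib)
  ultimately have "(\<lambda>t. total_departures \<epsilon> (return_pmf s) (coin_policy p \<pi> \<rho>) i (Suc t) / real (Suc t))
      \<longlonglongrightarrow> p * r + (1 - p) * q" by simp
  then show ?thesis
    unfolding has_rate_iff_total_departures by (rule LIMSEQ_imp_Suc)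
qed

lemma convex_universal_rates: "convex (universal_rates \<epsilon>)"
proof (rule convexI)
  fix x y :: "real \<times> real" and u v :: real
  assume x: "x \<in> universal_rates \<epsilon>" and y: "y \<in> universal_rates \<epsilon>"
    and u: "0 \<le> u" and v: "0 \<le> v" and uv: "u + v = 1"
  from x obtain \<pi> where \<pi>: "has_rate \<epsilon> (return_pmf s) \<pi> Q1 (fst x)"
    "has_rate \<epsilon> (return_pmf s) \<pi> Q2 (snd x)" for s
    unfolding universal_rates_def by blast
  from y obtain \<rho> where \<rho>: "has_rate \<epsilon> (return_pmf s) \<rho> Q1 (fst y)"
    "has_rate \<epsilon> (return_pmf s) \<rho> Q2 (snd y)" for s
    unfolding universal_rates_def by blast
  have v_eq: "v = 1 - u" using uv by simp
  have "u \<le> 1" using v uv by simp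
  then have "has_rate \<epsilon> (return_pmf s) (coin_policy u \<pi> \<rho>) Q1 (u * fst x + v * fst y)"
    "has_rate \<epsilon> (return_pmf s) (coin_policy u \<pi> \<rho>) Q2 (u * snd x + v * snd y)" for s
    unfolding v_eq using u \<pi> \<rho> by (simp_all add: has_rate_coin_policy)
  then show "u *\<^sub>R x + v *\<^sub>R y \<in> universal_rates \<epsilon>"
    unfolding universal_rates_def by (simp del: split_paired_All) blast
qed

text \<open>The two weighted averages converge, and Cramer's rule recovers the averages for the single queues
  from them.\<close>

lemma stationary_universal_rates:
  assumes v: "\<And>s. slack \<epsilon> v1 v2 g h s (\<sigma> s) = 0" and w: "\<And>s. slack \<epsilon> w1 w2 g' h' s (\<sigma> s) = 0"
    and det: "v1 * w2 - v2 * w1 \<noteq> 0"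
    and r: "v1 * r1 + v2 * r2 = g" "w1 * r1 + w2 * r2 = g'"
  shows "(r1, r2) \<in> universal_rates \<epsilon>"
proof -
  define \<pi> :: policy where "\<pi> = (\<lambda>_ s. return_pmf (\<sigma> s))"
  define D where "D = v1 * w2 - v2 * w1"
  have "D \<noteq> 0" using det by (simp add: D_def)
  have "has_rate \<epsilon> (return_pmf s) \<pi> Q1 r1 \<and> has_rate \<epsilon> (return_pmf s) \<pi> Q2 r2" for s
  proof -
    let ?X = "\<lambda>t. total_departures \<epsilon> (return_pmf s) \<pi> Q1 t"
    let ?Y = "\<lambda>t. total_departures \<epsilon> (return_pmf s) \<pi> Q2 t"
    have V: "(\<lambda>t. (v1 * ?X t + v2 * ?Y t) / t) \<longlonglongrightarrow> g"
      and W: "(\<lambda>t. (w1 * ?X t + w2 * ?Y t) / t) \<longlonglongrightarrow> g'"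
      unfolding \<pi>_def by (rule weighted_rate_stationary[OF v], rule weighted_rate_stationary[OF w])
    have "(\<lambda>t. (w2 * ((v1 * ?X t + v2 * ?Y t) / t) - v2 * ((w1 * ?X t + w2 * ?Y t) / t)) / D)
        \<longlonglongrightarrow> (w2 * g - v2 * g') / D"
      by (intro tendsto_intros V W \<open>D \<noteq> 0\<close>)
    moreover have "(w2 * ((v1 * x + v2 * y) / n) - v2 * ((w1 * x + w2 * y) / n)) / D = x / n" for x y n
      using \<open>D \<noteq> 0\<close> by (cases "n = 0") (simp_all add: D_def divide_simps, simp add: algebra_simps)
    moreover have "(w2 * g - v2 * g') / D = r1"
      using \<open>D \<noteq> 0\<close> by (simp add: D_def divide_simps flip: r) (simp add: algebra_simps)
    ultimately have "(\<lambda>t. ?X t / t) \<longlonglongrightarrow> r1" by simp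
    have "(\<lambda>t. (v1 * ((w1 * ?X t + w2 * ?Y t) / t) - w1 * ((v1 * ?X t + v2 * ?Y t) / t)) / D)
        \<longlonglongrightarrow> (v1 * g' - w1 * g) / D"
      by (intro tendsto_intros V W \<open>D \<noteq> 0\<close>)
    moreover have "(v1 * ((w1 * x + w2 * y) / n) - w1 * ((v1 * x + v2 * y) / n)) / D = y / n" for x y n
      using \<open>D \<noteq> 0\<close> by (cases "n = 0") (simp_all add: D_def divide_simps, simp add: algebra_simps)
    moreover have "(v1 * g' - w1 * g) / D = r2"
      using \<open>D \<noteq> 0\<close> by (simp add: D_def divide_simps flip: r) (simp add: algebra_simps)
    ultimately have "(\<lambda>t. ?Y t / t) \<longlonglongrightarrow> r2" by simp
    with \<open>(\<lambda>t. ?X t / t) \<longlonglongrightarrow> r1\<close> show ?thesis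
      by (simp add: has_rate_iff_total_departures)
  qed
  then show ?thesis
    unfolding universal_rates_def by (simp del: split_paired_All) blast
qed

section \<open>Potentials for the edges\<close>

text \<open>Splitting all five disjunctions turns a statement about the Bellman inequality into sixteen
  rational identities in \<open>\<epsilon>\<close>.\<close>

lemma state_action_cases:
  fixes s :: state and a :: action
  obtains m c1 c2 where "s = (m, c1, c2)" "m = Q1 \<or> m = Q2" "c1 = True \<or> c1 = False"
    "c2 = True \<or> c2 = False" "a = Stay \<or> a = Switch"
  by (metis (full_types) action.exhaust queue.exhaust surj_pair)

text \<open>The edge between the policies \<open>always_first\<close> and \<open>prefer_first\<close> below, for slowly changing
  channels. At the first queue the potential depends on the first channel only: on this edge it does not
  matter, at the first queue with its channel OFF, whether an ON channel at the second queue is used.\<close>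

fun potential_outer_slow :: "real \<Rightarrow> state \<Rightarrow> real" where
  "potential_outer_slow \<epsilon> (Q1, c1, c2) = (if c1 then (1 - \<epsilon>)\<^sup>2 / (2 * \<epsilon>) else 0)"
| "potential_outer_slow \<epsilon> (Q2, c1, c2) =
     (if c1 then (1 - \<epsilon>)\<^sup>2 * (1 - 2 * \<epsilon>) / (2 * \<epsilon>) else if c2 then \<epsilon> else 0)"

text \<open>Closed form of the slack, written so that its sign is visible for \<open>\<epsilon> \<le> 1 / 2\<close>, except
  for \<open>1 - 4 * \<epsilon> + 2 * \<epsilon>\<^sup>2\<close>, whose sign separates slow from fast channels.\<close>

fun gap_outer_slow :: "real \<Rightarrow> state \<Rightarrow> action \<Rightarrow> real" where
  "gap_outer_slow \<epsilon> (Q1, True, True) Switch = (1 - \<epsilon>) * (2 - 3 * \<epsilon>)"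
| "gap_outer_slow \<epsilon> (Q1, True, False) Switch = (1 - \<epsilon>) * (2 - 3 * \<epsilon>) + \<epsilon>\<^sup>2 * (1 - 2 * \<epsilon>)"
| "gap_outer_slow \<epsilon> (Q1, False, False) Switch = \<epsilon> * (1 - \<epsilon>) * (1 - 2 * \<epsilon>)"
| "gap_outer_slow \<epsilon> (Q2, True, True) Stay = 1 - 4 * \<epsilon> + 2 * \<epsilon>\<^sup>2"
| "gap_outer_slow \<epsilon> (Q2, True, False) Stay = (1 - 2 * \<epsilon>) * (1 - \<epsilon> + \<epsilon>\<^sup>2)"
| "gap_outer_slow \<epsilon> (Q2, False, True) Switch = \<epsilon>"
| "gap_outer_slow \<epsilon> (Q2, False, False) Stay = \<epsilon> * (1 - \<epsilon>) * (1 - 2 * \<epsilon>)"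
| "gap_outer_slow \<epsilon> _ _ = 0"

lemma slack_outer_slow:
  assumes "0 < \<epsilon>" and "\<epsilon> \<le> 1 / 2"
  shows "slack \<epsilon> ((1 - \<epsilon>)\<^sup>2) \<epsilon> ((1 - \<epsilon>)\<^sup>2 / 2) (potential_outer_slow \<epsilon>) s a = gap_outer_slow \<epsilon> s a"
proof -
  obtain m c1 c2 where "s = (m, c1, c2)" "m = Q1 \<or> m = Q2" "c1 = True \<or> c1 = False"
    "c2 = True \<or> c2 = False" "a = Stay \<or> a = Switch" by (rule state_action_cases)
  then show ?thesis
    using assms by (elim disjE; simp add: slack_def departure_def expectation_kernel;
      simp add: field_simps power_numeral_reduce)
qed

lemma slack_outer_slow_nonneg:
  assumes "0 < \<epsilon>" and "\<epsilon> \<le> 1 / 2" and "0 \<le> 1 - 4 * \<epsilon> + 2 * \<epsilon>\<^sup>2"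
  shows "0 \<le> slack \<epsilon> ((1 - \<epsilon>)\<^sup>2) \<epsilon> ((1 - \<epsilon>)\<^sup>2 / 2) (potential_outer_slow \<epsilon>) s a"
proof -
  have "0 \<le> gap_outer_slow \<epsilon> s a"
    by (cases "(\<epsilon>, s, a)" rule: gap_outer_slow.cases)
      (use assms in \<open>auto intro!: add_nonneg_nonneg mult_nonneg_nonneg\<close>)
  then show ?thesis using assms by (simp add: slack_outer_slow)
qed

text \<open>The edge between \<open>prefer_first\<close> and \<open>prefer_connected\<close>, for slowly changing channels. The two
  policies differ only at the second queue with both channels ON, where both actions have slack
  zero here.\<close>

fun potential_inner_slow :: "real \<Rightarrow> state \<Rightarrow> real" where
  "potential_inner_slow \<epsilon> (Q1, True, True) = (1 + \<epsilon> - \<epsilon>\<^sup>2) / (2 * \<epsilon>)"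
| "potential_inner_slow \<epsilon> (Q1, True, False) = (3 + 6 * \<epsilon> - 18 * \<epsilon>\<^sup>2 + 8 * \<epsilon>^3) / (8 * \<epsilon> * (1 - \<epsilon>))"
| "potential_inner_slow \<epsilon> (Q1, False, True) = (3 - 14 * \<epsilon> + 14 * \<epsilon>\<^sup>2 - 4 * \<epsilon>^3) / (8 * \<epsilon> * (1 - \<epsilon>))"
| "potential_inner_slow \<epsilon> (Q2, True, True) = (1 - \<epsilon> - 3 * \<epsilon>\<^sup>2 + 2 * \<epsilon>^3) / (2 * \<epsilon>)"
| "potential_inner_slow \<epsilon> (Q2, True, False) =
     (3 - 2 * \<epsilon> - 18 * \<epsilon>\<^sup>2 + 24 * \<epsilon>^3 - 8 * \<epsilon>^4) / (8 * \<epsilon> * (1 - \<epsilon>))"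
| "potential_inner_slow \<epsilon> (Q2, False, True) = (3 - 6 * \<epsilon> - 2 * \<epsilon>\<^sup>2 + 4 * \<epsilon>^3) / (8 * \<epsilon> * (1 - \<epsilon>))"
| "potential_inner_slow \<epsilon> (m, False, False) = 0"

fun gap_inner_slow :: "real \<Rightarrow> state \<Rightarrow> action \<Rightarrow> real" where
  "gap_inner_slow \<epsilon> (Q1, True, True) Switch = 2 - \<epsilon>\<^sup>2"
| "gap_inner_slow \<epsilon> (Q1, True, False) Switch = 2 + \<epsilon> - 4 * \<epsilon>\<^sup>2 + 2 * \<epsilon>^3"
| "gap_inner_slow \<epsilon> (Q1, False, True) Stay = 1 - 4 * \<epsilon> + 2 * \<epsilon>\<^sup>2"
| "gap_inner_slow \<epsilon> (Q1, False, False) Switch = \<epsilon>\<^sup>2 * (3 - 2 * \<epsilon>)"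
| "gap_inner_slow \<epsilon> (Q2, True, False) Stay = (1 - \<epsilon>)\<^sup>2 * (1 + 2 * \<epsilon>)"
| "gap_inner_slow \<epsilon> (Q2, False, True) Switch = (2 - \<epsilon>) * (1 - 2 * \<epsilon>)"
| "gap_inner_slow \<epsilon> (Q2, False, False) Stay = \<epsilon>\<^sup>2 * (3 - 2 * \<epsilon>)"
| "gap_inner_slow \<epsilon> _ _ = 0"

lemma slack_inner_slow:
  assumes "0 < \<epsilon>" and "\<epsilon> \<le> 1 / 2"
  shows "slack \<epsilon> (1 + \<epsilon> - \<epsilon>\<^sup>2) (1 - \<epsilon>) (3 / 4 - \<epsilon> / 2) (potential_inner_slow \<epsilon>) s a = gap_inner_slow \<epsilon> s a"
proof -
  obtain m c1 c2 where "s = (m, c1, c2)" "m = Q1 \<or> m = Q2" "c1 = True \<or> c1 = False"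
    "c2 = True \<or> c2 = False" "a = Stay \<or> a = Switch" by (rule state_action_cases)
  moreover have "1 - \<epsilon> \<noteq> 0" "\<epsilon> \<noteq> 0" using assms by auto
  ultimately show ?thesis
    using assms by (elim disjE; simp add: slack_def departure_def expectation_kernel;
      simp add: divide_simps power_numeral_reduce; simp add: algebra_simps)
qed

lemma slack_inner_slow_nonneg:
  assumes "0 < \<epsilon>" and "\<epsilon> \<le> 1 / 2" and "0 \<le> 1 - 4 * \<epsilon> + 2 * \<epsilon>\<^sup>2"
  shows "0 \<le> slack \<epsilon> (1 + \<epsilon> - \<epsilon>\<^sup>2) (1 - \<epsilon>) (3 / 4 - \<epsilon> / 2) (potential_inner_slow \<epsilon>) s a"
proof -
  have sq: "\<epsilon>\<^sup>2 \<le> 1 / 4"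
    using power_mono[of \<epsilon> "1/2" 2] assms by (simp add: power_divide)
  have "0 < \<epsilon> ^ 3" using assms by simp
  have "0 \<le> gap_inner_slow \<epsilon> s a"
    by (cases "(\<epsilon>, s, a)" rule: gap_inner_slow.cases)
      (use assms sq \<open>0 < \<epsilon> ^ 3\<close> in \<open>auto intro!: mult_nonneg_nonneg\<close>)
  then show ?thesis using assms by (simp add: slack_inner_slow)
qed

text \<open>The edge of maximal total rate, between \<open>prefer_connected\<close> and its mirror image. It is symmetric
  under exchange of the queues: when exactly one channel is ON, only whether the server is at that
  queue matters.\<close>

fun potential_sum :: "real \<Rightarrow> state \<Rightarrow> real" where
  "potential_sum \<epsilon> (m, True, True) = 1 / (2 * \<epsilon>)"
| "potential_sum \<epsilon> (m, True, False) =
     (if m = Q1 then 3 - 4 * \<epsilon>\<^sup>2 else 3 - 8 * \<epsilon> + 4 * \<epsilon>\<^sup>2) / (8 * \<epsilon> * (1 - \<epsilon>))"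
| "potential_sum \<epsilon> (m, False, True) =
     (if m = Q2 then 3 - 4 * \<epsilon>\<^sup>2 else 3 - 8 * \<epsilon> + 4 * \<epsilon>\<^sup>2) / (8 * \<epsilon> * (1 - \<epsilon>))"
| "potential_sum \<epsilon> (m, False, False) = 0"

fun gap_sum :: "real \<Rightarrow> state \<Rightarrow> action \<Rightarrow> real" where
  "gap_sum \<epsilon> (m, True, True) Switch = 1"
| "gap_sum \<epsilon> (Q1, True, False) Switch = 2 * (1 - \<epsilon>)"
| "gap_sum \<epsilon> (Q1, False, True) Stay = 1 - 2 * \<epsilon>"
| "gap_sum \<epsilon> (Q2, True, False) Stay = 1 - 2 * \<epsilon>"
| "gap_sum \<epsilon> (Q2, False, True) Switch = 2 * (1 - \<epsilon>)"
| "gap_sum \<epsilon> _ _ = 0"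

lemma slack_sum:
  assumes "0 < \<epsilon>" and "\<epsilon> \<le> 1 / 2"
  shows "slack \<epsilon> 1 1 (3 / 4 - \<epsilon> / 2) (potential_sum \<epsilon>) s a = gap_sum \<epsilon> s a"
proof -
  obtain m c1 c2 where "s = (m, c1, c2)" "m = Q1 \<or> m = Q2" "c1 = True \<or> c1 = False"
    "c2 = True \<or> c2 = False" "a = Stay \<or> a = Switch" by (rule state_action_cases)
  moreover have "1 - \<epsilon> \<noteq> 0" "\<epsilon> \<noteq> 0" using assms by auto
  ultimately show ?thesis
    using assms by (elim disjE; simp add: slack_def departure_def expectation_kernel;
      simp add: divide_simps power_numeral_reduce; simp add: algebra_simps)
qed

lemma slack_sum_nonneg:
  assumes "0 < \<epsilon>" and "\<epsilon> \<le> 1 / 2"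
  shows "0 \<le> slack \<epsilon> 1 1 (3 / 4 - \<epsilon> / 2) (potential_sum \<epsilon>) s a"
proof -
  have "0 \<le> gap_sum \<epsilon> s a"
    by (cases "(\<epsilon>, s, a)" rule: gap_sum.cases) (use assms in auto)
  then show ?thesis using assms by (simp add: slack_sum)
qed

text \<open>The edge between \<open>always_first\<close> and \<open>prefer_connected\<close>, for quickly changing channels. At the
  second queue with both channels ON it is now staying that has slack zero, and switching that
  costs \<open>(4 * \<epsilon> - 2 * \<epsilon>\<^sup>2 - 1) / \<epsilon>\<close>.\<close>

fun potential_outer_fast :: "real \<Rightarrow> state \<Rightarrow> real" where
  "potential_outer_fast \<epsilon> (Q1, c1, c2) = (if c1 then (1 - \<epsilon>) * (3 - 2 * \<epsilon>) / (2 * \<epsilon>) else 0)"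
| "potential_outer_fast \<epsilon> (Q2, True, True) = (1 - 3 * \<epsilon> + 8 * \<epsilon>\<^sup>2 - 4 * \<epsilon>^3) / (2 * \<epsilon>)"
| "potential_outer_fast \<epsilon> (Q2, True, False) = (1 - \<epsilon>) * (3 - 2 * \<epsilon>) * (1 - 2 * \<epsilon>) / (2 * \<epsilon>)"
| "potential_outer_fast \<epsilon> (Q2, False, c2) = (if c2 then 1 else 0)"

fun gap_outer_fast :: "real \<Rightarrow> state \<Rightarrow> action \<Rightarrow> real" where
  "gap_outer_fast \<epsilon> (Q1, True, True) Switch = (1 - \<epsilon>)\<^sup>2 * (1 + 2 * \<epsilon>) / \<epsilon>"
| "gap_outer_fast \<epsilon> (Q1, True, False) Switch = 1 + (1 - 2 * \<epsilon>) * (2 + 2 * (1 - \<epsilon>) * (2 - \<epsilon>))"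
| "gap_outer_fast \<epsilon> (Q1, False, False) Switch = \<epsilon> * (1 - 2 * \<epsilon>) * (3 - 2 * \<epsilon>)"
| "gap_outer_fast \<epsilon> (Q2, True, True) Switch = (4 * \<epsilon> - 2 * \<epsilon>\<^sup>2 - 1) / \<epsilon>"
| "gap_outer_fast \<epsilon> (Q2, True, False) Stay = (1 - 2 * \<epsilon>) * (4 - 5 * \<epsilon> + 2 * \<epsilon>\<^sup>2)"
| "gap_outer_fast \<epsilon> (Q2, False, True) Switch = 1"
| "gap_outer_fast \<epsilon> (Q2, False, False) Stay = \<epsilon> * (1 - 2 * \<epsilon>) * (3 - 2 * \<epsilon>)"
| "gap_outer_fast \<epsilon> _ _ = 0"

lemma slack_outer_fast:
  assumes "0 < \<epsilon>" and "\<epsilon> \<le> 1 / 2"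
  shows "slack \<epsilon> ((1 - \<epsilon>) * (3 - 2 * \<epsilon>)) 1 ((1 - \<epsilon>) * (3 - 2 * \<epsilon>) / 2) (potential_outer_fast \<epsilon>) s a
    = gap_outer_fast \<epsilon> s a"
proof -
  obtain m c1 c2 where "s = (m, c1, c2)" "m = Q1 \<or> m = Q2" "c1 = True \<or> c1 = False"
    "c2 = True \<or> c2 = False" "a = Stay \<or> a = Switch" by (rule state_action_cases)
  moreover have "1 - \<epsilon> \<noteq> 0" "\<epsilon> \<noteq> 0" using assms by auto
  ultimately show ?thesis
    using assms by (elim disjE; simp add: slack_def departure_def expectation_kernel;
      simp add: divide_simps power_numeral_reduce; simp add: algebra_simps)
qed

lemma slack_outer_fast_nonneg:
  assumes "0 < \<epsilon>" and "\<epsilon> \<le> 1 / 2" and "1 - 4 * \<epsilon> + 2 * \<epsilon>\<^sup>2 \<le> 0"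
  shows "0 \<le> slack \<epsilon> ((1 - \<epsilon>) * (3 - 2 * \<epsilon>)) 1 ((1 - \<epsilon>) * (3 - 2 * \<epsilon>) / 2) (potential_outer_fast \<epsilon>) s a"
proof -
  have "0 \<le> gap_outer_fast \<epsilon> s a"
    by (cases "(\<epsilon>, s, a)" rule: gap_outer_fast.cases)
      (use assms in \<open>auto intro!: add_nonneg_nonneg mult_nonneg_nonneg divide_nonneg_nonneg\<close>)
  then show ?thesis using assms by (simp add: slack_outer_fast)
qed

section \<open>Policies at the vertices\<close>

text \<open>The policies are described by the queue where the server should be in the next slot.\<close>

definition go_to :: "queue \<Rightarrow> queue \<Rightarrow> action" where
  "go_to q m = (if m = q then Stay else Switch)"

fun always_first :: "state \<Rightarrow> action" where
  "always_first (m, c1, c2) = go_to Q1 m"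

fun prefer_first :: "state \<Rightarrow> action" where
  "prefer_first (m, c1, c2) = go_to (if \<not> c1 \<and> c2 then Q2 else Q1) m"

fun prefer_connected :: "state \<Rightarrow> action" where
  "prefer_connected (m, c1, c2) =
     go_to (if c1 = c2 then if c1 then m else Q1 else if c1 then Q1 else Q2) m"

lemma origin_universal: "(0, 0) \<in> universal_rates \<epsilon>"
  by (rule stationary_universal_rates[of \<epsilon> 1 0 0 "\<lambda>_. 0" "\<lambda>_. Switch" 0 1 0 "\<lambda>_. 0"])
    (auto simp: slack_def departure_def)

text \<open>The first channel is ON half of the time. Its relative value function has the
  factor \<open>1 / (2 * \<epsilon>)\<close> because the channel forgets its state at rate \<open>2 * \<epsilon>\<close>; the
  slot lost in switching lets it decay by \<open>1 - 2 * \<epsilon>\<close>.\<close>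

lemma always_first_universal:
  assumes "0 < \<epsilon>" and "\<epsilon> \<le> 1 / 2"
  shows "(1 / 2, 0) \<in> universal_rates \<epsilon>"
proof (rule stationary_universal_rates)
  let ?h = "\<lambda>(m, c1, c2). if c1 then (if m = Q1 then 1 else 1 - 2 * \<epsilon>) / (2 * \<epsilon>) else 0"
  show "slack \<epsilon> 1 0 (1 / 2) ?h s (always_first s) = 0" for s
  proof -
    obtain m c1 c2 where s: "s = (m, c1, c2)" by (rule prod_cases3)
    show ?thesis
      unfolding s using assms
      by (cases m; cases c1) (simp_all add: slack_def departure_def expectation_kernel go_to_def
          divide_simps power2_eq_square, simp_all add: algebra_simps)
  qed
  show "slack \<epsilon> 0 1 0 (\<lambda>_. 0) s (always_first s) = 0" for s
  proof -
    obtain m c1 c2 where s: "s = (m, c1, c2)" by (rule prod_cases3)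
    show ?thesis
      unfolding s by (cases m) (simp_all add: slack_def departure_def go_to_def)
  qed
qed simp_all

lemma gap_prefer_first:
  "gap_outer_slow \<epsilon> s (prefer_first s) = 0" "gap_inner_slow \<epsilon> s (prefer_first s) = 0"
proof -
  obtain m c1 c2 where s: "s = (m, c1, c2)" by (rule prod_cases3)
  show "gap_outer_slow \<epsilon> s (prefer_first s) = 0" "gap_inner_slow \<epsilon> s (prefer_first s) = 0"
    unfolding s by (cases m; cases c1; cases c2; simp add: go_to_def)+
qed

lemma gap_prefer_connected:
  "gap_inner_slow \<epsilon> s (prefer_connected s) = 0" "gap_sum \<epsilon> s (prefer_connected s) = 0"
proof -
  obtain m c1 c2 where s: "s = (m, c1, c2)" by (rule prod_cases3)
  show "gap_inner_slow \<epsilon> s (prefer_connected s) = 0" "gap_sum \<epsilon> s (prefer_connected s) = 0"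
    unfolding s by (cases m; cases c1; cases c2; simp add: go_to_def)+
qed

text \<open>The intersection of the outer and the inner edge for slow channels; the determinant of the
  two edges is \<open>1 - 4 * \<epsilon> + 2 * \<epsilon>\<^sup>2\<close>, hence the last hypothesis.\<close>

lemma prefer_first_universal:
  assumes "0 < \<epsilon>" and "\<epsilon> \<le> 1 / 2" and "1 - 4 * \<epsilon> + 2 * \<epsilon>\<^sup>2 \<noteq> 0"
  shows "((2 - \<epsilon>) / 4, (1 - \<epsilon>)\<^sup>2 / 4) \<in> universal_rates \<epsilon>"
proof (rule stationary_universal_rates)
  show "slack \<epsilon> ((1 - \<epsilon>)\<^sup>2) \<epsilon> ((1 - \<epsilon>)\<^sup>2 / 2) (potential_outer_slow \<epsilon>) s (prefer_first s) = 0" for s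
    using assms by (simp add: slack_outer_slow gap_prefer_first)
  show "slack \<epsilon> (1 + \<epsilon> - \<epsilon>\<^sup>2) (1 - \<epsilon>) (3 / 4 - \<epsilon> / 2) (potential_inner_slow \<epsilon>) s (prefer_first s) = 0" for s
    using assms by (simp add: slack_inner_slow gap_prefer_first)
  have "(1 - \<epsilon>)\<^sup>2 * (1 - \<epsilon>) - \<epsilon> * (1 + \<epsilon> - \<epsilon>\<^sup>2) = 1 - 4 * \<epsilon> + 2 * \<epsilon>\<^sup>2"
    by (simp add: algebra_simps power_numeral_reduce)
  then show "(1 - \<epsilon>)\<^sup>2 * (1 - \<epsilon>) - \<epsilon> * (1 + \<epsilon> - \<epsilon>\<^sup>2) \<noteq> 0"
    using assms(3) by simp
qed (simp_all add: field_simps power_numeral_reduce)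

text \<open>The zero slack for the inner edge holds for fast channels too, although that edge is then not
  valid for all policies. The pair of lines is therefore used in both regimes; the edge for fast
  channels would be parallel to the sum rate edge at \<open>\<epsilon> = 1 / 2\<close>.\<close>

lemma prefer_connected_universal:
  assumes "0 < \<epsilon>" and "\<epsilon> \<le> 1 / 2"
  shows "((3 - 2 * \<epsilon>) / (4 * (2 - \<epsilon>)), (1 - \<epsilon>) * (3 - 2 * \<epsilon>) / (4 * (2 - \<epsilon>)))
    \<in> universal_rates \<epsilon>"
proof (rule stationary_universal_rates)
  show "slack \<epsilon> (1 + \<epsilon> - \<epsilon>\<^sup>2) (1 - \<epsilon>) (3 / 4 - \<epsilon> / 2) (potential_inner_slow \<epsilon>) s (prefer_connected s) = 0" for s
    using assms by (simp add: slack_inner_slow gap_prefer_connected)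
  show "slack \<epsilon> 1 1 (3 / 4 - \<epsilon> / 2) (potential_sum \<epsilon>) s (prefer_connected s) = 0" for s
    using assms by (simp add: slack_sum gap_prefer_connected)
  have "(1 + \<epsilon> - \<epsilon>\<^sup>2) * 1 - (1 - \<epsilon>) * 1 = \<epsilon> * (2 - \<epsilon>)"
    by (simp add: algebra_simps power2_eq_square)
  then show "(1 + \<epsilon> - \<epsilon>\<^sup>2) * 1 - (1 - \<epsilon>) * 1 \<noteq> 0"
    using assms by simp
qed (use assms in \<open>simp_all add: divide_simps power2_eq_square, simp_all add: algebra_simps\<close>)

section \<open>The polygon as a fan of triangles\<close>

text \<open>The cross products say that \<open>(l1, l2)\<close> lies in the cone spanned by two points of \<open>S\<close>, and the
  inequality puts it on the origin's side of the line through them; so it lies in the triangle that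
  they span with the origin.\<close>

lemma convex_sector:
  fixes S :: "(real \<times> real) set"
  assumes "convex S" and "(0, 0) \<in> S" and "(v1, v2) \<in> S" and "(w1, w2) \<in> S"
    and det: "0 < v1 * w2 - v2 * w1"
    and v: "0 \<le> v1 * l2 - v2 * l1" and w: "0 \<le> l1 * w2 - l2 * w1"
    and "n1 * v1 + n2 * v2 = c" and "n1 * w1 + n2 * w2 = c" and "0 < c"
    and "n1 * l1 + n2 * l2 \<le> c"
  shows "(l1, l2) \<in> S"
proof -
  define D where "D = v1 * w2 - v2 * w1"
  define \<alpha> where "\<alpha> = (l1 * w2 - l2 * w1) / D"
  define \<beta> where "\<beta> = (v1 * l2 - v2 * l1) / D"
  have D: "0 < D" using det by (simp add: D_def)
  have \<alpha>\<beta>: "0 \<le> \<alpha>" "0 \<le> \<beta>" using v w D by (simp_all add: \<alpha>_def \<beta>_def)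
  have l1: "l1 = \<alpha> * v1 + \<beta> * w1"
  proof -
    have "\<alpha> * v1 + \<beta> * w1 = ((l1 * w2 - l2 * w1) * v1 + (v1 * l2 - v2 * l1) * w1) / D"
      by (simp add: \<alpha>_def \<beta>_def add_divide_distrib)
    also have "\<dots> = (l1 * D) / D" by (simp add: D_def algebra_simps)
    finally show ?thesis using D by simp
  qed
  have l2: "l2 = \<alpha> * v2 + \<beta> * w2"
  proof -
    have "\<alpha> * v2 + \<beta> * w2 = ((l1 * w2 - l2 * w1) * v2 + (v1 * l2 - v2 * l1) * w2) / D"
      by (simp add: \<alpha>_def \<beta>_def add_divide_distrib)
    also have "\<dots> = (l2 * D) / D" by (simp add: D_def algebra_simps)
    finally show ?thesis using D by simp
  qed
  have "(\<alpha> + \<beta>) * c = \<alpha> * (n1 * v1 + n2 * v2) + \<beta> * (n1 * w1 + n2 * w2)"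
    using assms by (simp add: algebra_simps)
  also have "\<dots> = n1 * l1 + n2 * l2" by (simp add: l1 l2 algebra_simps)
  finally have "(\<alpha> + \<beta>) * c \<le> 1 * c" using assms by simp
  then have le1: "\<alpha> + \<beta> \<le> 1" using \<open>0 < c\<close> by (simp only: mult_le_cancel_right_pos)
  have "(l1, l2) = (1 - \<alpha> - \<beta>) *\<^sub>R (0, 0) + \<alpha> *\<^sub>R (v1, v2) + \<beta> *\<^sub>R (w1, w2)"
    using l1 l2 by simp
  then have "(l1, l2) \<in> convex hull {(0, 0), (v1, v2), (w1, w2)}"
    unfolding convex_hull_3 using \<alpha>\<beta> le1
    by (intro CollectI exI[of _ "1 - \<alpha> - \<beta>"] exI[of _ \<alpha>] exI[of _ \<beta>]) simp
  also have "\<dots> \<subseteq> S"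
    using assms by (intro hull_minimal) auto
  finally show ?thesis .
qed

text \<open>The sector between \<open>prefer_connected\<close>, whose rates have the ratio \<open>1 - \<epsilon>\<close>, and its mirror image.\<close>

lemma sum_rate_sector_universal:
  assumes \<epsilon>: "0 < \<epsilon>" "\<epsilon> \<le> 1 / 2" and "0 \<le> l2" and "l2 \<le> l1"
    and sector: "(1 - \<epsilon>) * l1 \<le> l2" and facet: "l1 + l2 \<le> 3 / 4 - \<epsilon> / 2"
  shows "(l1, l2) \<in> universal_rates \<epsilon>"
proof -
  \<comment> \<open>the larger of the two rates of \<open>prefer_connected\<close>; the other one is \<open>(1 - \<epsilon>) * k\<close>\<close>
  define k where "k = (3 - 2 * \<epsilon>) / (4 * (2 - \<epsilon>))"
  have k: "0 < k" "k * (2 - \<epsilon>) = 3 / 4 - \<epsilon> / 2"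
    using \<epsilon> by (simp_all add: k_def field_simps)
  have mem: "(k, (1 - \<epsilon>) * k) \<in> universal_rates \<epsilon>"
    using prefer_connected_universal[OF \<epsilon>] by (simp add: k_def)
  show ?thesis
  proof (rule convex_sector[OF convex_universal_rates origin_universal mem universal_rates_swap[OF mem],
        where ?n1.0 = 1 and ?n2.0 = 1 and c = "3 / 4 - \<epsilon> / 2"])
    have "k * k - (1 - \<epsilon>) * k * ((1 - \<epsilon>) * k) = k * k * (\<epsilon> * (2 - \<epsilon>))"
      by (simp add: algebra_simps)
    then show "0 < k * k - (1 - \<epsilon>) * k * ((1 - \<epsilon>) * k)" using k \<epsilon> by simp
    have "k * l2 - (1 - \<epsilon>) * k * l1 = k * (l2 - (1 - \<epsilon>) * l1)" by (simp add: algebra_simps)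
    then show "0 \<le> k * l2 - (1 - \<epsilon>) * k * l1" using k sector by simp
    have "l1 * k - l2 * ((1 - \<epsilon>) * k) = k * ((l1 - l2) + \<epsilon> * l2)" by (simp add: algebra_simps)
    then show "0 \<le> l1 * k - l2 * ((1 - \<epsilon>) * k)" using k \<epsilon> assms by simp
  qed (use k facet \<epsilon> in \<open>simp_all add: algebra_simps\<close>)
qed

text \<open>The half of the polygon with \<open>l2 \<le> l1\<close> is covered by three sectors, bounded by the directions of
  \<open>prefer_first\<close> and \<open>prefer_connected\<close>.\<close>

lemma slow_region_universal:
  assumes \<epsilon>: "0 < \<epsilon>" "\<epsilon> \<le> 1 / 2" and slow: "0 < 1 - 4 * \<epsilon> + 2 * \<epsilon>\<^sup>2"
    and l: "0 \<le> l2" "l2 \<le> l1"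
    and A: "(1 - \<epsilon>)\<^sup>2 * l1 + \<epsilon> * l2 \<le> (1 - \<epsilon>)\<^sup>2 / 2"
    and B: "(1 + \<epsilon> - \<epsilon>\<^sup>2) * l1 + (1 - \<epsilon>) * l2 \<le> 3 / 4 - \<epsilon> / 2"
    and C: "l1 + l2 \<le> 3 / 4 - \<epsilon> / 2"
  shows "(l1, l2) \<in> universal_rates \<epsilon>"
proof -
  have mem1: "((2 - \<epsilon>) / 4, (1 - \<epsilon>)\<^sup>2 / 4) \<in> universal_rates \<epsilon>"
    using \<epsilon> slow by (intro prefer_first_universal) auto
  consider "(1 - \<epsilon>) * l1 \<le> l2" | "(1 - \<epsilon>)\<^sup>2 * l1 \<le> (2 - \<epsilon>) * l2" "l2 \<le> (1 - \<epsilon>) * l1"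
    | "(2 - \<epsilon>) * l2 \<le> (1 - \<epsilon>)\<^sup>2 * l1" by linarith
  then show ?thesis
  proof cases
    case 1
    then show ?thesis using assms by (intro sum_rate_sector_universal) auto
  next
    case 2
    define k where "k = (3 - 2 * \<epsilon>) / (4 * (2 - \<epsilon>))"
    have k: "0 < k" "k * (2 - \<epsilon>) = 3 / 4 - \<epsilon> / 2"
      using \<epsilon> by (simp_all add: k_def field_simps)
    have mem2: "(k, (1 - \<epsilon>) * k) \<in> universal_rates \<epsilon>"
      using prefer_connected_universal[OF \<epsilon>] by (simp add: k_def)
    show ?thesis
    proof (rule convex_sector[OF convex_universal_rates origin_universal mem1 mem2,
          where ?n1.0 = "1 + \<epsilon> - \<epsilon>\<^sup>2" and ?n2.0 = "1 - \<epsilon>" and c = "3 / 4 - \<epsilon> / 2"])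
      have "(2 - \<epsilon>) / 4 * ((1 - \<epsilon>) * k) - (1 - \<epsilon>)\<^sup>2 / 4 * k = (1 - \<epsilon>) * k / 4"
        by (simp add: field_simps power2_eq_square)
      also have "0 < \<dots>" using k \<epsilon> by simp
      finally show "0 < (2 - \<epsilon>) / 4 * ((1 - \<epsilon>) * k) - (1 - \<epsilon>)\<^sup>2 / 4 * k" .
      show "0 \<le> (2 - \<epsilon>) / 4 * l2 - (1 - \<epsilon>)\<^sup>2 / 4 * l1" using 2 by simp
      have "l1 * ((1 - \<epsilon>) * k) - l2 * k = k * ((1 - \<epsilon>) * l1 - l2)" by (simp add: algebra_simps)
      then show "0 \<le> l1 * ((1 - \<epsilon>) * k) - l2 * k" using k 2 by simp
      have "(1 + \<epsilon> - \<epsilon>\<^sup>2) * k + (1 - \<epsilon>) * ((1 - \<epsilon>) * k) = k * (2 - \<epsilon>)"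
        by (simp add: algebra_simps power2_eq_square)
      then show "(1 + \<epsilon> - \<epsilon>\<^sup>2) * k + (1 - \<epsilon>) * ((1 - \<epsilon>) * k) = 3 / 4 - \<epsilon> / 2" using k by simp
      show "(1 + \<epsilon> - \<epsilon>\<^sup>2) * ((2 - \<epsilon>) / 4) + (1 - \<epsilon>) * ((1 - \<epsilon>)\<^sup>2 / 4) = 3 / 4 - \<epsilon> / 2"
        by (simp add: field_simps power_numeral_reduce)
    qed (use B \<epsilon> in simp_all)
  next
    case 3
    show ?thesis
    proof (rule convex_sector[OF convex_universal_rates origin_universal always_first_universal[OF \<epsilon>] mem1,
          where ?n1.0 = "(1 - \<epsilon>)\<^sup>2" and ?n2.0 = \<epsilon> and c = "(1 - \<epsilon>)\<^sup>2 / 2"])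
      show "(1 - \<epsilon>)\<^sup>2 * ((2 - \<epsilon>) / 4) + \<epsilon> * ((1 - \<epsilon>)\<^sup>2 / 4) = (1 - \<epsilon>)\<^sup>2 / 2"
        by (simp add: field_simps)
      show "0 \<le> l1 * ((1 - \<epsilon>)\<^sup>2 / 4) - l2 * ((2 - \<epsilon>) / 4)"
        using 3 by (simp add: algebra_simps)
    qed (use A \<epsilon> l in simp_all)
  qed
qed

lemma fast_region_universal:
  assumes \<epsilon>: "0 < \<epsilon>" "\<epsilon> \<le> 1 / 2" and l: "0 \<le> l2" "l2 \<le> l1"
    and D: "(1 - \<epsilon>) * (3 - 2 * \<epsilon>) * l1 + l2 \<le> (1 - \<epsilon>) * (3 - 2 * \<epsilon>) / 2"
    and C: "l1 + l2 \<le> 3 / 4 - \<epsilon> / 2"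
  shows "(l1, l2) \<in> universal_rates \<epsilon>"
proof (cases "(1 - \<epsilon>) * l1 \<le> l2")
  case True
  then show ?thesis using assms by (intro sum_rate_sector_universal) auto
next
  case False
  define k where "k = (3 - 2 * \<epsilon>) / (4 * (2 - \<epsilon>))"
  have k: "0 < k" "k * (2 - \<epsilon>) = (3 - 2 * \<epsilon>) / 4"
    using \<epsilon> by (simp_all add: k_def field_simps)
  have mem2: "(k, (1 - \<epsilon>) * k) \<in> universal_rates \<epsilon>"
    using prefer_connected_universal[OF \<epsilon>] by (simp add: k_def)
  show ?thesis
  proof (rule convex_sector[OF convex_universal_rates origin_universal always_first_universal[OF \<epsilon>] mem2,
        where ?n1.0 = "(1 - \<epsilon>) * (3 - 2 * \<epsilon>)" and ?n2.0 = 1 and c = "(1 - \<epsilon>) * (3 - 2 * \<epsilon>) / 2"])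
    have "(1 - \<epsilon>) * (3 - 2 * \<epsilon>) * k + 1 * ((1 - \<epsilon>) * k) = 2 * (1 - \<epsilon>) * (k * (2 - \<epsilon>))"
      by (simp add: algebra_simps)
    also have "\<dots> = (1 - \<epsilon>) * (3 - 2 * \<epsilon>) / 2"
      unfolding k by simp
    finally show "(1 - \<epsilon>) * (3 - 2 * \<epsilon>) * k + 1 * ((1 - \<epsilon>) * k) = (1 - \<epsilon>) * (3 - 2 * \<epsilon>) / 2" .
    have "l1 * ((1 - \<epsilon>) * k) - l2 * k = k * ((1 - \<epsilon>) * l1 - l2)" by (simp add: algebra_simps)
    then show "0 \<le> l1 * ((1 - \<epsilon>) * k) - l2 * k" using k False by simp
  qed (use D k \<epsilon> l in simp_all)
qed

section \<open>The rate region\<close>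

text \<open>The discriminating polynomial is \<open>2 * (1 - \<epsilon>)\<^sup>2 - 1\<close>; the bound on \<open>\<epsilon>\<close> excludes its larger root.\<close>

lemma less_critical_iff:
  fixes \<epsilon> :: real
  assumes "\<epsilon> \<le> 1 / 2"
  shows "\<epsilon> < 1 - sqrt 2 / 2 \<longleftrightarrow> 0 < 1 - 4 * \<epsilon> + 2 * \<epsilon>\<^sup>2"
proof -
  have "\<epsilon> < 1 - sqrt 2 / 2 \<longleftrightarrow> sqrt 2 < 2 * (1 - \<epsilon>)" by auto
  also have "\<dots> \<longleftrightarrow> sqrt 2 < sqrt ((2 * (1 - \<epsilon>))\<^sup>2)" using assms by simp
  also have "\<dots> \<longleftrightarrow> 0 < 1 - 4 * \<epsilon> + 2 * \<epsilon>\<^sup>2"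
    by (simp only: real_sqrt_less_iff) (auto simp: power2_eq_square algebra_simps)
  finally show ?thesis .
qed

theorem theorem3:
  fixes \<epsilon> :: real and m0 :: queue and p1 p2 :: "bool pmf"
  assumes "0 < \<epsilon>" and "\<epsilon> \<le> 1 / 2"
  shows "rate_region \<epsilon> (initial_state m0 p1 p2) =
    {(l1, l2). 0 \<le> l1 \<and> 0 \<le> l2 \<and>
      (\<epsilon> < 1 - sqrt 2 / 2 \<longrightarrow>
         \<epsilon> * l1 + (1 - \<epsilon>)^2 * l2 \<le> (1 - \<epsilon>)^2 / 2 \<and>
         (1 - \<epsilon>) * l1 + (1 + \<epsilon> - \<epsilon>^2) * l2 \<le> 3 / 4 - \<epsilon> / 2 \<and>
         l1 + l2 \<le> 3 / 4 - \<epsilon> / 2 \<and>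
         (1 + \<epsilon> - \<epsilon>^2) * l1 + (1 - \<epsilon>) * l2 \<le> 3 / 4 - \<epsilon> / 2 \<and>
         (1 - \<epsilon>)^2 * l1 + \<epsilon> * l2 \<le> (1 - \<epsilon>)^2 / 2) \<and>
      (\<epsilon> \<ge> 1 - sqrt 2 / 2 \<longrightarrow>
         l1 + (1 - \<epsilon>) * (3 - 2 * \<epsilon>) * l2 \<le> (1 - \<epsilon>) * (3 - 2 * \<epsilon>) / 2 \<and>
         l1 + l2 \<le> 3 / 4 - \<epsilon> / 2 \<and>
         (1 - \<epsilon>) * (3 - 2 * \<epsilon>) * l1 + l2 \<le> (1 - \<epsilon>) * (3 - 2 * \<epsilon>) / 2)}"
  (is "?R = ?P")
proof (rule set_eqI, rule prod.exhaust)
  fix x :: "real \<times> real" and l1 l2 :: real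
  assume x: "x = (l1, l2)"
  note \<epsilon> = assms
  note slow = less_critical_iff[OF \<epsilon>(2)]
  show "x \<in> ?R \<longleftrightarrow> x \<in> ?P"
  proof
    assume "x \<in> ?R"
    then obtain \<pi> where r: "has_rate \<epsilon> (initial_state m0 p1 p2) \<pi> Q1 l1"
      "has_rate \<epsilon> (initial_state m0 p1 p2) \<pi> Q2 l2"
      unfolding x rate_region_def by auto
    note nonneg = r[THEN has_rate_nonneg]
    have C: "1 * l1 + 1 * l2 \<le> 3 / 4 - \<epsilon> / 2"
      by (rule weighted_rate_le[OF slack_sum_nonneg[OF \<epsilon>] r])
    show "x \<in> ?P"
    proof (cases "\<epsilon> < 1 - sqrt 2 / 2")
      case True
      then have "0 \<le> 1 - 4 * \<epsilon> + 2 * \<epsilon>\<^sup>2" using slow by simp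
      note A = slack_outer_slow_nonneg[OF \<epsilon> this] and B = slack_inner_slow_nonneg[OF \<epsilon> this]
      show ?thesis
        unfolding x using nonneg C True
          weighted_rate_le[OF A r] weighted_rate_le_swap[OF A r]
          weighted_rate_le[OF B r] weighted_rate_le_swap[OF B r] by simp
    next
      case False
      then have "1 - 4 * \<epsilon> + 2 * \<epsilon>\<^sup>2 \<le> 0" using slow by simp
      note D = slack_outer_fast_nonneg[OF \<epsilon> this]
      show ?thesis
        unfolding x using nonneg C False
          weighted_rate_le[OF D r] weighted_rate_le_swap[OF D r] by simp
    qed
  next
    assume "x \<in> ?P"
    have "(l1, l2) \<in> universal_rates \<epsilon>"
    proof (cases "l2 \<le> l1"; cases "\<epsilon> < 1 - sqrt 2 / 2")
      assume "l2 \<le> l1" "\<epsilon> < 1 - sqrt 2 / 2"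
      then show ?thesis
        using \<open>x \<in> ?P\<close> slow by (intro slow_region_universal \<epsilon>) (simp_all add: x)
    next
      assume "l2 \<le> l1" "\<not> \<epsilon> < 1 - sqrt 2 / 2"
      then show ?thesis
        using \<open>x \<in> ?P\<close> by (intro fast_region_universal \<epsilon>) (simp_all add: x)
    next
      assume "\<not> l2 \<le> l1" "\<epsilon> < 1 - sqrt 2 / 2"
      then show ?thesis
        using \<open>x \<in> ?P\<close> slow
        by (intro universal_rates_swap[OF slow_region_universal] \<epsilon>) (simp_all add: x add.commute)
    next
      assume "\<not> l2 \<le> l1" "\<not> \<epsilon> < 1 - sqrt 2 / 2"
      then show ?thesis
        using \<open>x \<in> ?P\<close>
        by (intro universal_rates_swap[OF fast_region_universal] \<epsilon>) (simp_all add: x add.commute)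
    qed
    then show "x \<in> ?R"
      unfolding x using universal_rates_subset_rate_region by blast
  qed
qed

end
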